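(* Let $\lambda\in\mathcal{T}$ and suppose that $(A_\lambda,q_\lambda)$ is post-critically finite. Then $A_\lambda$ has the bounded turning property.
   Context: For $\lambda$ in the open unit disk $\mathbb{D}$ let $A_\lambda=\{\sum_{n=0}^\infty a_n\lambda^n:\ a_n\in\{0,1\}\}$, so $A_\lambda=\lambda A_\lambda\cup(\lambda A_\lambda+1)$. Let $\mathcal{T}=\{\lambda\in\mathbb{D}:\ \lambda A_\lambda\cap(\lambda A_\lambda+1)\text{ is a single point } o_\lambda\}$ (then $o_\lambda=\frac{1}{2(1-\lambda)}$). For $\lambda\in\mathcal{T}$ define $q_\lambda:A_\lambda\to A_\lambda$ by $q_\lambda(z)=z/\lambda$ if $z\in\lambda A_\lambda$ and $q_\lambda(z)=\frac{1-z}{\lambda}+\frac{1}{1-\lambda}$ if $z\in\lambda A_\lambda+1$. $(A_\lambda,q_\lambda)$ is post-critically finite if $o_\lambda$ is strictly preperiodic under $q_\lambda$. A connected, locally connected set $X\subset\mathbb{C}$ has the bounded turning property if there is $L$ such that for all $z_0,z_1\in X$ there is a connected set $[z_0,z_1]\subset X$ containing $z_0,z_1$ with $\operatorname{diam}[z_0,z_1]\le L|z_0-z_1|$. *)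

theory Defs
  imports "HOL-Analysis.Analysis"
begin

definition attr :: "complex \<Rightarrow> complex set" where
  "attr l = {z. \<exists>a::nat \<Rightarrow> bool. (\<lambda>n. (if a n then 1 else 0) * l ^ n) sums z}"

definition Tset :: "complex set" where
  "Tset = {l. norm l < 1 \<and> (\<exists>p. ((\<lambda>z. l * z) ` attr l) \<inter> ((\<lambda>z. l * z + 1) ` attr l) = {p})}"

definition opt :: "complex \<Rightarrow> complex" where
  "opt l = 1 / (2 * (1 - l))"

text \<open>The map q_lambda on A_lambda (the two branches agree at the intersection point).\<close>
definition qmap :: "complex \<Rightarrow> complex \<Rightarrow> complex" where
  "qmap l z = (if z \<in> (\<lambda>w. l * w) ` attr l then z / l else (1 - z) / l + 1 / (1 - l))"

definition pcf :: "complex \<Rightarrow> bool" where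
  "pcf l \<longleftrightarrow> (\<exists>m n. m \<noteq> n \<and> (qmap l ^^ m) (opt l) = (qmap l ^^ n) (opt l))
              \<and> \<not> (\<exists>p. p \<ge> 1 \<and> (qmap l ^^ p) (opt l) = opt l)"

definition bounded_turning :: "complex set \<Rightarrow> bool" where
  "bounded_turning X \<longleftrightarrow> connected X \<and> locally connected X \<and>
     (\<exists>L. \<forall>z0\<in>X. \<forall>z1\<in>X. \<exists>C. C \<subseteq> X \<and> connected C \<and> bounded C \<and> z0 \<in> C \<and> z1 \<in> C
          \<and> diameter C \<le> L * norm (z0 - z1))"

end

theory Submission
  imports Defs
begin

text \<open>
  The map \<open>q\<close> has two affine inverse branches, both contracting by \<open>\<bar>\<lambda>\<bar>\<close>, whose images of \<open>A\<close> meet only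
  in \<open>o\<close> and are exchanged by the rotation by \<open>\<pi>\<close> about \<open>o\<close>. Two points in the same image are
  separated further by \<open>q\<close> without changing the ratio to be bounded, so only points \<open>x\<close>, \<open>y\<close> in
  different images matter; these are joined through \<open>o\<close>. After applying \<open>q\<close>, everything reduces to
  two estimates at the points \<open>p\<close> of the critical orbit: \<open>x\<close> can be joined to \<open>p\<close> by a set of
  diameter at most \<open>L \<bar>x - p\<bar>\<close>, and \<open>\<bar>x - p\<bar> \<le> K \<bar>(x - p) + (y - p)\<bar>\<close>. Both follow by pushing
  forward with \<open>q\<close> until the points leave the image containing \<open>p\<close>; there compactness gives a
  lower bound, which is uniform because the critical orbit is finite.
\<close>

section \<open>General facts\<close>

lemma finite_orbit:
  fixes f :: "'a \<Rightarrow> 'a"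
  assumes "m < n" and eq: "(f ^^ m) x = (f ^^ n) x"
  shows "finite (range (\<lambda>k. (f ^^ k) x))"
proof -
  have "(f ^^ k) x \<in> (\<lambda>k. (f ^^ k) x) ` {..<n}" for k
  proof (induction k rule: less_induct)
    case (less k)
    show ?case
    proof (cases "k < n")
      case False
      have "(f ^^ k) x = (f ^^ (k - n)) ((f ^^ n) x)"
        using False by (metis comp_apply funpow_add le_add_diff_inverse2 not_less)
      also have "\<dots> = (f ^^ (k - n + m)) x"
        by (simp add: eq[symmetric] funpow_add)
      finally show ?thesis
        using less[of "k - n + m"] False \<open>m < n\<close> by simp
    qed auto
  qed
  then show ?thesis
    by (meson finite_imageI finite_lessThan finite_subset image_subsetI)
qed

text \<open>Whenever \<open>P s\<close> is not settled at once, \<open>s\<close> is replaced by some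
  \<open>t\<close> whose \<open>m\<close> is larger by the factor 1/r. The bound \<open>D\<close>
  allows this only finitely often, and \<open>P\<close> is then pulled back along the chain. In all
  later uses \<open>m\<close> is a distance, \<open>r\<close> is \<open>norm l\<close>, and
  \<open>t\<close> is the image of \<open>s\<close> under \<open>qmap l\<close>.\<close>

lemma expansion_descent:
  fixes m :: "'a \<Rightarrow> real"
  assumes r: "0 < r" "r < 1"
    and bound: "\<And>s. s \<in> S \<Longrightarrow> m s \<le> D"
    and step: "\<And>s. s \<in> S \<Longrightarrow> 0 < m s \<Longrightarrow> P s \<or> (\<exists>t\<in>S. m s = r * m t \<and> (P t \<longrightarrow> P s))"
    and s: "s \<in> S" "0 < m s"
  shows "P s"
proof -
  have *: "D * r ^ n < m s \<Longrightarrow> s \<in> S \<Longrightarrow> 0 < m s \<Longrightarrow> P s" for n s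
  proof (induction n arbitrary: s)
    case 0
    then show ?case using bound[of s] by simp
  next
    case (Suc n)
    from step[OF Suc.prems(2,3)] show ?case
    proof
      assume "\<exists>t\<in>S. m s = r * m t \<and> (P t \<longrightarrow> P s)"
      then obtain t where t: "t \<in> S" "m s = r * m t" "P t \<longrightarrow> P s" by blast
      have "r * (D * r ^ n) < r * m t" using Suc.prems(1) t(2) by (simp add: mult_ac)
      then have "D * r ^ n < m t" using r by simp
      moreover have "0 < m t" using Suc.prems(3) t(2) r by (simp add: zero_less_mult_iff)
      ultimately show ?thesis using Suc.IH t by blast
    qed
  qed
  have "(\<lambda>n. D * r ^ n) \<longlonglongrightarrow> D * 0"
    using r by (intro tendsto_intros LIMSEQ_power_zero) auto
  then have "\<forall>\<^sub>F n in sequentially. D * r ^ n < m s"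
    using s(2) by (intro order_tendstoD) auto
  then obtain n where "D * r ^ n < m s"
    by (auto simp: eventually_sequentially)
  with * s show ?thesis by blast
qed

text \<open>The diameter bound is an absolute number, not a ratio: such bounds add up under
  concatenation and scale by \<open>norm l\<close> under the inverse branches.\<close>

definition joinable :: "'a::real_normed_vector set \<Rightarrow> real \<Rightarrow> 'a \<Rightarrow> 'a \<Rightarrow> bool" where
  "joinable X d x y \<longleftrightarrow> (\<exists>C. C \<subseteq> X \<and> connected C \<and> bounded C \<and> x \<in> C \<and> y \<in> C \<and> diameter C \<le> d)"

lemma joinable_mono: "joinable X d x y \<Longrightarrow> d \<le> e \<Longrightarrow> joinable X e x y"
  unfolding joinable_def by (meson order_trans)

lemma joinable_refl: "x \<in> X \<Longrightarrow> 0 \<le> d \<Longrightarrow> joinable X d x x"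
  unfolding joinable_def by (rule exI[of _ "{x}"]) auto

lemma joinable_sym: "joinable X d x y \<Longrightarrow> joinable X d y x"
  unfolding joinable_def by blast

lemma joinable_trans:
  assumes "joinable X d x y" "joinable X e y z"
  shows "joinable X (d + e) x z"
proof -
  obtain C where C: "C \<subseteq> X" "connected C" "bounded C" "x \<in> C" "y \<in> C" "diameter C \<le> d"
    using assms(1) unfolding joinable_def by blast
  obtain E where E: "E \<subseteq> X" "connected E" "bounded E" "y \<in> E" "z \<in> E" "diameter E \<le> e"
    using assms(2) unfolding joinable_def by blast
  have dC: "norm (u - v) \<le> d" if "u \<in> C" "v \<in> C" for u v
    using diameter_bounded_bound[OF C(3) that] C(6) by (simp add: dist_norm)
  have dE: "norm (u - v) \<le> e" if "u \<in> E" "v \<in> E" for u v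
    using diameter_bounded_bound[OF E(3) that] E(6) by (simp add: dist_norm)
  have pos: "0 \<le> d" "0 \<le> e" using dC[OF C(4) C(4)] dE[OF E(4) E(4)] by auto
  have cross: "norm (u - v) \<le> d + e" if "u \<in> C" "v \<in> E" for u v
    using norm_triangle_ineq[of "u - y" "y - v"] dC[OF that(1) C(5)] dE[OF E(4) that(2)] by simp
  have "norm (u - v) \<le> d + e" if "u \<in> C \<union> E" "v \<in> C \<union> E" for u v
    using that dC[of u v] dE[of u v] cross[of u v] cross[of v u] pos
    by (auto simp: norm_minus_commute)
  then have "diameter (C \<union> E) \<le> d + e"
    using pos by (intro diameter_le) auto
  moreover have "connected (C \<union> E)"
    using C E by (intro connected_Un) auto
  ultimately show ?thesis
    unfolding joinable_def using C E by (intro exI[of _ "C \<union> E"]) auto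
qed

text \<open>Points within \<open>e / L\<close> of \<open>x\<close> are joined to \<open>x\<close> by
  sets of diameter below \<open>e\<close>, which stay in the ball of radius \<open>e\<close>. The
  union of these sets is connected since all contain \<open>x\<close>; it need not be open, as it
  only has to contain an open neighbourhood.\<close>

lemma locally_connected_if_joinable:
  assumes "0 < L" and join: "\<And>x y. x \<in> X \<Longrightarrow> y \<in> X \<Longrightarrow> joinable X (L * norm (x - y)) x y"
  shows "locally connected X"
proof (rule locallyI)
  fix W x assume W: "openin (top_of_set X) W" "x \<in> W"
  then obtain e where e: "e > 0" "ball x e \<inter> X \<subseteq> W"
    by (meson openin_contains_ball)
  have x: "x \<in> X" using W by (meson openin_imp_subset subsetD)
  define U where "U = ball x (e / L) \<inter> X"
  have "\<exists>C. C \<subseteq> X \<and> connected C \<and> x \<in> C \<and> y \<in> C \<and> C \<subseteq> W" if y: "y \<in> U" for y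
  proof -
    obtain C where C: "C \<subseteq> X" "connected C" "bounded C" "x \<in> C" "y \<in> C"
        "diameter C \<le> L * norm (x - y)"
      using join[OF x, of y] y unfolding U_def joinable_def by blast
    have "L * norm (x - y) < e"
      using y \<open>0 < L\<close> by (simp add: U_def dist_norm field_simps)
    then have "C \<subseteq> ball x e"
      using diameter_bounded_bound[OF C(3,4)] C(6) by (force simp: mem_ball)
    with C e show ?thesis by blast
  qed
  then obtain C where C: "\<And>y. y \<in> U \<Longrightarrow>
      C y \<subseteq> X \<and> connected (C y) \<and> x \<in> C y \<and> y \<in> C y \<and> C y \<subseteq> W"
    by metis
  have xU: "x \<in> U" using x e \<open>0 < L\<close> by (simp add: U_def)
  have "connected (\<Union>y\<in>U. C y)"
    using C by (intro connected_Union) (auto dest: C)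
  moreover have "openin (top_of_set X) U"
    unfolding U_def by (simp add: Int_commute openin_open_Int)
  moreover have "U \<subseteq> (\<Union>y\<in>U. C y)" "(\<Union>y\<in>U. C y) \<subseteq> W"
    using C by auto
  ultimately show "\<exists>U V. openin (top_of_set X) U \<and> connected V \<and> x \<in> U \<and> U \<subseteq> V \<and> V \<subseteq> W"
    using xU by (intro exI[of _ U] exI[of _ "\<Union>y\<in>U. C y"]) simp
qed

section \<open>The attractor\<close>

locale contraction =
  fixes l :: complex
  assumes norm_l: "norm l < 1" and l_nz: "l \<noteq> 0"
begin

text \<open>These are the inverses of the two formulas in \<open>qmap\<close>. The second differs
  from the usual 1 + l z by the symmetry of the attractor, and is chosen so that the point
  reflection about \<open>opt l\<close> exchanges the two maps.\<close>

definition branch :: "bool \<Rightarrow> complex \<Rightarrow> complex" where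
  "branch b z = (if b then 2 * opt l - l * z else l * z)"

lemma l_neq_1: "l \<noteq> 1"
  using norm_l by auto

lemma two_opt: "2 * opt l = 1 / (1 - l)"
  using l_neq_1 by (simp add: opt_def field_simps)

lemma branch_dist: "norm (branch b x - branch b y) = norm l * norm (x - y)"
proof -
  have "branch b x - branch b y = (if b then - (l * (x - y)) else l * (x - y))"
    by (simp add: branch_def algebra_simps)
  then show ?thesis by (simp add: norm_mult)
qed

lemma branch_inj: "branch b x = branch b y \<Longrightarrow> x = y"
  using l_nz by (auto simp: branch_def split: if_splits)

lemma continuous_branch: "continuous_on X (branch b)"
  by (cases b) (auto simp: branch_def[abs_def] intro!: continuous_intros)

lemma summable_digits: "summable (\<lambda>n. (if a n then 1 else 0) * l ^ n)"
proof (rule summable_comparison_test')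
  show "summable (\<lambda>n. norm l ^ n)" using norm_l by (simp add: summable_geometric)
  show "norm ((if a n then 1 else 0) * l ^ n) \<le> norm l ^ n" if "n \<ge> 0" for n
    by (simp add: norm_power)
qed

lemma bounded_attr: "bounded (attr l)"
proof -
  have "norm z \<le> (\<Sum>n. norm l ^ n)" if z: "z \<in> attr l" for z
  proof -
    obtain a :: "nat \<Rightarrow> bool" where "(\<lambda>n. (if a n then 1 else 0) * l ^ n) sums z"
      using z unfolding attr_def by blast
    then have z: "z = (\<Sum>n. (if a n then 1 else 0) * l ^ n)" by (simp add: sums_iff)
    show ?thesis unfolding z
      using norm_l by (intro norm_suminf_le) (auto simp: norm_power summable_geometric)
  qed
  then show ?thesis by (auto simp: bounded_iff)
qed

lemma attr_Cons:
  assumes "z \<in> attr l"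
  shows "(if b then 1 else 0) + l * z \<in> attr l"
proof -
  obtain a :: "nat \<Rightarrow> bool" where a: "(\<lambda>n. (if a n then 1 else 0) * l ^ n) sums z"
    using assms unfolding attr_def by blast
  define a' where "a' = case_nat b a"
  have "(\<lambda>n. (if a' (Suc n) then 1 else 0) * l ^ Suc n) sums (l * z)"
    using sums_mult[OF a, of l] by (simp add: a'_def mult_ac)
  then have "(\<lambda>n. (if a' n then 1 else 0) * l ^ n) sums (l * z + (if a' 0 then 1 else 0) * l ^ 0)"
    by (rule sums_Suc)
  then show ?thesis by (auto simp: attr_def a'_def add.commute)
qed

lemma attr_decomp:
  assumes "z \<in> attr l"
  shows "\<exists>b. \<exists>w\<in>attr l. z = (if b then 1 else 0) + l * w"
proof -
  obtain a :: "nat \<Rightarrow> bool" where a: "(\<lambda>n. (if a n then 1 else 0) * l ^ n) sums z"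
    using assms unfolding attr_def by blast
  let ?w = "\<Sum>n. (if a (Suc n) then 1 else 0) * l ^ n"
  have w: "(\<lambda>n. (if a (Suc n) then 1 else 0) * l ^ n) sums ?w"
    by (rule summable_sums) (rule summable_digits)
  have "(\<lambda>n. (if a (Suc n) then 1 else 0) * l ^ Suc n) sums (l * ?w)"
    using sums_mult[OF w, of l] by (simp add: mult_ac)
  then have "(\<lambda>n. (if a n then 1 else 0) * l ^ n) sums (l * ?w + (if a 0 then 1 else 0) * l ^ 0)"
    by (rule sums_Suc)
  with a have "z = l * ?w + (if a 0 then 1 else 0) * l ^ 0" by (rule sums_unique2)
  moreover have "?w \<in> attr l" using w unfolding attr_def by (intro CollectI exI[of _ "\<lambda>n. a (Suc n)"])
  ultimately show ?thesis by (intro exI[of _ "a 0"] bexI[of _ ?w]) auto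
qed

text \<open>Complementing every digit subtracts the series from the full geometric series, whose sum
  1 / (1 - l) is \<open>2 * opt l\<close>.\<close>

lemma attr_flip:
  assumes "z \<in> attr l"
  shows "2 * opt l - z \<in> attr l"
proof -
  obtain a :: "nat \<Rightarrow> bool" where a: "(\<lambda>n. (if a n then 1 else 0) * l ^ n) sums z"
    using assms unfolding attr_def by blast
  have "(\<lambda>n. l ^ n) sums (2 * opt l)"
    unfolding two_opt using norm_l by (rule geometric_sums)
  from sums_diff[OF this a]
  have "(\<lambda>n. (if \<not> a n then 1 else 0) * l ^ n) sums (2 * opt l - z)"
    by (rule sums_cong[THEN iffD1, rotated]) simp
  then show ?thesis unfolding attr_def by (intro CollectI exI[of _ "\<lambda>n. \<not> a n"])
qed

lemma branch_True: "branch True z = 1 + l * (2 * opt l - z)"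
  using l_neq_1 unfolding branch_def two_opt by (simp add: field_simps)

lemma branch_in: "z \<in> attr l \<Longrightarrow> branch b z \<in> attr l"
  using attr_Cons[of z False] attr_Cons[OF attr_flip, of z True]
  by (cases b) (simp_all add: branch_True, simp add: branch_def)

lemma attr_cases:
  assumes "z \<in> attr l"
  obtains b w where "w \<in> attr l" "z = branch b w"
proof -
  obtain b w where w: "w \<in> attr l" "z = (if b then 1 else 0) + l * w"
    using attr_decomp[OF assms] by blast
  show thesis
  proof (cases b)
    case True
    then show thesis
      using w that[OF attr_flip[OF w(1)], of True] by (simp add: branch_True)
  next
    case False
    then show thesis
      using w that[OF w(1), of False] by (simp add: branch_def)
  qed
qed

text \<open>The closure inherits the decomposition into first digit and remainder, because the union
  of its two affine images is compact and contains the attractor. Reading off digits repeatedly then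
  expands every point of the closure as a power series in \<open>l\<close>.\<close>

lemma closed_attr: "closed (attr l)"
proof -
  let ?K = "closure (attr l)"
  have cK: "compact ?K" using bounded_attr by (simp add: compact_closure)
  have "\<exists>b. \<exists>w\<in>?K. z = (if b then 1 else 0) + l * w" if z: "z \<in> ?K" for z
  proof -
    have "compact ((\<lambda>w. l * w) ` ?K \<union> (\<lambda>w. 1 + l * w) ` ?K)"
      by (intro compact_Un compact_continuous_image cK continuous_intros)
    moreover have "attr l \<subseteq> (\<lambda>w. l * w) ` ?K \<union> (\<lambda>w. 1 + l * w) ` ?K"
    proof
      fix z assume "z \<in> attr l"
      then obtain b w where "w \<in> attr l" "z = (if b then 1 else 0) + l * w"
        using attr_decomp by blast
      then show "z \<in> (\<lambda>w. l * w) ` ?K \<union> (\<lambda>w. 1 + l * w) ` ?K"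
        using closure_subset[of "attr l"] by (cases b) auto
    qed
    ultimately have "?K \<subseteq> (\<lambda>w. l * w) ` ?K \<union> (\<lambda>w. 1 + l * w) ` ?K"
      by (intro closure_minimal) (auto simp: compact_imp_closed)
    then consider w where "w \<in> ?K" "z = l * w" | w where "w \<in> ?K" "z = 1 + l * w"
      using z by blast
    then show ?thesis
    proof cases
      case 1
      then show ?thesis by (intro exI[of _ False] bexI[of _ w]) auto
    next
      case 2
      then show ?thesis by (intro exI[of _ True] bexI[of _ w]) auto
    qed
  qed
  then obtain B N where BN: "\<And>z. z \<in> ?K \<Longrightarrow> N z \<in> ?K \<and> z = (if B z then 1 else 0) + l * N z"
    by metis
  have "z \<in> attr l" if z: "z \<in> ?K" for z
  proof -
    define a where "a n = B ((N ^^ n) z)" for n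
    have inK: "(N ^^ n) z \<in> ?K" for n
      by (induction n) (auto simp: z BN)
    \<comment> \<open>After \<open>n\<close> digits the error is \<open>l ^ n\<close> times a point
      of the bounded closure, so it tends to 0.\<close>
    have expand: "z = (\<Sum>k<n. (if a k then 1 else 0) * l ^ k) + l ^ n * (N ^^ n) z" for n
    proof (induction n)
      case (Suc n)
      have "(N ^^ n) z = (if a n then 1 else 0) + l * (N ^^ Suc n) z"
        using BN[OF inK[of n]] by (simp add: a_def)
      then have "l ^ n * (N ^^ n) z = l ^ n * ((if a n then 1 else 0) + l * (N ^^ Suc n) z)"
        by (rule arg_cong)
      also have "\<dots> = (if a n then 1 else 0) * l ^ n + l ^ Suc n * (N ^^ Suc n) z"
        by (simp add: algebra_simps)
      finally show ?case using Suc by (simp only: sum.lessThan_Suc add.assoc)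
    qed simp
    obtain M where M: "\<And>w. w \<in> ?K \<Longrightarrow> norm w \<le> M"
      using compact_imp_bounded[OF cK] by (auto simp: bounded_iff)
    have "(\<lambda>n. l ^ n * (N ^^ n) z) \<longlonglongrightarrow> 0"
    proof (rule Lim_null_comparison)
      show "\<forall>\<^sub>F n in sequentially. norm (l ^ n * (N ^^ n) z) \<le> norm l ^ n * M"
        using M[OF inK] by (auto simp: norm_mult norm_power intro!: always_eventually mult_left_mono)
      show "(\<lambda>n. norm l ^ n * M) \<longlonglongrightarrow> 0"
        using norm_l by (intro tendsto_mult_left_zero LIMSEQ_power_zero) auto
    qed
    then have "(\<lambda>n. z - l ^ n * (N ^^ n) z) \<longlonglongrightarrow> z - 0"
      by (intro tendsto_intros)
    moreover have "z - l ^ n * (N ^^ n) z = (\<Sum>k<n. (if a k then 1 else 0) * l ^ k)" for n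
      using expand[of n] by (simp add: algebra_simps)
    ultimately have "(\<lambda>n. (if a n then 1 else 0) * l ^ n) sums z"
      by (simp add: sums_def)
    then show ?thesis by (auto simp: attr_def)
  qed
  then have "?K = attr l" using closure_subset by blast
  then show ?thesis by (metis closed_closure)
qed

lemma compact_attr: "compact (attr l)"
  using bounded_attr closed_attr by (simp add: compact_eq_bounded_closed)

end

section \<open>The overlap point, inverse branches of \<open>qmap\<close>, and connectedness\<close>

locale single_overlap =
  fixes l :: complex
  assumes in_Tset: "l \<in> Tset"

sublocale single_overlap \<subseteq> contraction
proof
  show "norm l < 1" using in_Tset by (simp add: Tset_def)
  show "l \<noteq> 0"
  proof
    assume "l = 0"
    then have "((\<lambda>z. l * z) ` attr l) \<inter> ((\<lambda>z. l * z + 1) ` attr l) = {}" by auto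
    then show False using in_Tset by (auto simp: Tset_def)
  qed
qed

context single_overlap
begin

text \<open>The reflection z -> 2 o - z about o = \<open>opt l\<close> exchanges the two images, so
  it maps their intersection to itself. A unique common point must be its fixed point o.\<close>

lemma overlap_eq: "branch False ` attr l \<inter> branch True ` attr l = {opt l}"
proof -
  let ?I = "branch False ` attr l \<inter> branch True ` attr l"
  have "branch True ` attr l = (\<lambda>z. l * z + 1) ` attr l"
  proof (intro equalityI subsetI)
    fix z assume "z \<in> branch True ` attr l"
    then show "z \<in> (\<lambda>z. l * z + 1) ` attr l"
      using attr_flip by (auto simp: branch_True add.commute)
  next
    fix z assume "z \<in> (\<lambda>z. l * z + 1) ` attr l"
    then obtain w where "w \<in> attr l" "z = l * w + 1" by auto
    then show "z \<in> branch True ` attr l"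
      using attr_flip by (intro image_eqI[of _ _ "2 * opt l - w"]) (auto simp: branch_True)
  qed
  moreover have "branch False ` attr l = (\<lambda>z. l * z) ` attr l"
    by (simp add: branch_def)
  ultimately obtain p where p: "?I = {p}"
    using in_Tset by (auto simp: Tset_def)
  then obtain x y where xy: "x \<in> attr l" "y \<in> attr l" "p = branch False x" "p = branch True y"
    by blast
  have "2 * opt l - p = branch False y" "2 * opt l - p = branch True x"
    using xy(4) by (simp add: branch_def, simp only: xy(3) branch_def if_True if_False)
  then have "2 * opt l - p \<in> ?I" using xy by blast
  then have "2 * opt l = 2 * p" using p by (simp add: algebra_simps)
  then show ?thesis using p by simp
qed

lemma branch_overlap:
  assumes "x \<in> attr l" "y \<in> attr l" "branch (\<not> b) x = branch b y"
  shows "branch b y = opt l"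
proof -
  have "branch b y \<in> branch False ` attr l \<inter> branch True ` attr l"
    using assms by (cases b) (auto simp: image_iff, metis+)
  then show ?thesis unfolding overlap_eq by simp
qed

text \<open>Both branches take the critical value \<open>opt l / l\<close> to \<open>opt l\<close>,
  since the reflection exchanging them fixes \<open>opt l\<close>. Hence the two halves of the
  attractor are glued at the images of one and the same point.\<close>

lemma branch_eq_opt_iff: "branch b w = opt l \<longleftrightarrow> w = opt l / l"
proof -
  have "w = opt l / l \<longleftrightarrow> l * w = opt l"
    using l_nz by (metis nonzero_mult_div_cancel_left nonzero_eq_divide_eq mult.commute)
  moreover have "2 * opt l - l * w = opt l \<longleftrightarrow> l * w = opt l"
    unfolding mult_2 diff_eq_eq by auto
  ultimately show ?thesis by (simp add: branch_def)
qed

lemma opt_in: "opt l \<in> attr l"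
proof -
  have "opt l \<in> branch False ` attr l" using overlap_eq by blast
  then show ?thesis using branch_in by auto
qed

lemma crit_value_in: "opt l / l \<in> attr l"
proof -
  have "opt l \<in> branch False ` attr l" using overlap_eq by blast
  then obtain w where "w \<in> attr l" "branch False w = opt l" by auto
  then show ?thesis by (simp add: branch_eq_opt_iff)
qed

lemma qmap_branch:
  assumes "w \<in> attr l"
  shows "qmap l (branch b w) = w"
proof (cases "branch b w \<in> (\<lambda>w. l * w) ` attr l")
  case False
  then have b: b using assms by (auto simp: branch_def)
  have "qmap l (branch b w) = (1 - branch b w) / l + 1 / (1 - l)"
    using False by (simp add: qmap_def)
  also have "1 - branch b w = l * (w - 2 * opt l)"
    using b branch_True[of w] by (simp add: algebra_simps)
  also have "l * (w - 2 * opt l) / l + 1 / (1 - l) = w"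
    using l_nz by (simp add: two_opt)
  finally show ?thesis .
next
  case True
  then have q: "qmap l (branch b w) = branch b w / l" by (simp add: qmap_def)
  show ?thesis
  proof (cases b)
    case True
    \<comment> \<open>Here the point lies in both images although it was produced by the second
      branch. It is therefore \<open>opt l\<close>, where both formulas of \<open>qmap\<close> give
      \<open>opt l / l\<close>.\<close>
    obtain v where v: "v \<in> attr l" "branch b w = l * v"
      using \<open>branch b w \<in> (\<lambda>w. l * w) ` attr l\<close> by auto
    have "branch (\<not> b) v = branch b w" using True v by (simp add: branch_def)
    then have "branch b w = opt l" by (rule branch_overlap[OF v(1) assms])
    then show ?thesis using q by (metis branch_eq_opt_iff)
  qed (use q l_nz in \<open>simp add: branch_def\<close>)
qed

lemma qmap_opt: "qmap l (opt l) = opt l / l"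
  using qmap_branch[OF crit_value_in] branch_eq_opt_iff by metis

lemma qmap_cases:
  assumes "z \<in> attr l"
  obtains b where "qmap l z \<in> attr l" "z = branch b (qmap l z)"
  using attr_cases[OF assms] qmap_branch by metis

lemma qmap_in: "z \<in> attr l \<Longrightarrow> qmap l z \<in> attr l"
  using qmap_cases by metis

text \<open>A two-valued function that agrees on all pairs of points closer than some positive bound
  is constant on the attractor, by self-similarity. Membership in one side of a separation is such a
  function, because disjoint compact sets have positive distance.\<close>

lemma connected_attr: "connected (attr l)"
proof -
  obtain D where D: "\<And>x y. x \<in> attr l \<Longrightarrow> y \<in> attr l \<Longrightarrow> norm (x - y) < D"
  proof -
    obtain M where M: "\<And>x. x \<in> attr l \<Longrightarrow> norm x \<le> M"
      using bounded_attr by (auto simp: bounded_iff)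
    have "norm (x - y) < 2 * M + 1" if "x \<in> attr l" "y \<in> attr l" for x y
      using norm_triangle_ineq4[of x y] M[OF that(1)] M[OF that(2)] by linarith
    then show thesis using that by blast
  qed
  have const: "h x = h y"
    if "\<forall>x\<in>attr l. \<forall>y\<in>attr l. norm (x - y) < D * norm l ^ n \<longrightarrow> h x = h y"
      "x \<in> attr l" "y \<in> attr l" for n x y and h :: "complex \<Rightarrow> bool"
    using that
  proof (induction n arbitrary: h x y)
    case 0
    then show ?case using D by (metis mult.right_neutral power_0)
  next
    case (Suc n)
    \<comment> \<open>Composition with a branch relaxes the scale from n + 1 to n; this is why the
      induction must range over all \<open>h\<close>.\<close>
    have const: "h (branch b u) = h (branch b v)" if "u \<in> attr l" "v \<in> attr l" for b u v
    proof (rule Suc.IH[of "\<lambda>u. h (branch b u)", OF _ that], intro ballI impI)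
      fix u v assume uv: "u \<in> attr l" "v \<in> attr l" "norm (u - v) < D * norm l ^ n"
      then have "norm l * norm (u - v) < norm l * (D * norm l ^ n)" using l_nz by simp
      then have "norm (branch b u - branch b v) < D * norm l ^ Suc n"
        by (simp add: branch_dist mult_ac)
      then show "h (branch b u) = h (branch b v)"
        using Suc.prems(1) branch_in uv by blast
    qed
    \<comment> \<open>\<open>h\<close> is constant on each of the two images, and both contain
      \<open>opt l\<close>.\<close>
    have "h z = h (opt l)" if z: "z \<in> attr l" for z
    proof -
      obtain b where "qmap l z \<in> attr l" "z = branch b (qmap l z)"
        using qmap_cases[OF z] by blast
      moreover have "branch b (opt l / l) = opt l" by (simp only: branch_eq_opt_iff)
      ultimately show ?thesis using const[OF _ crit_value_in, of "qmap l z" b] by metis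
    qed
    then show ?case using Suc.prems(2,3) by blast
  qed
  show ?thesis
  proof (rule ccontr)
    assume "\<not> connected (attr l)"
    then obtain E F where EF: "closed E" "closed F" "attr l \<subseteq> E \<union> F" "E \<inter> F \<inter> attr l = {}"
        "E \<inter> attr l \<noteq> {}" "F \<inter> attr l \<noteq> {}"
      by (auto simp: connected_closed)
    have "compact (E \<inter> attr l)" "closed (F \<inter> attr l)" "E \<inter> attr l \<inter> (F \<inter> attr l) = {}"
      using EF compact_attr closed_attr by (auto intro: closed_Int_compact)
    from separate_compact_closed[OF this] obtain d where d: "d > 0"
        "\<And>x y. x \<in> E \<inter> attr l \<Longrightarrow> y \<in> F \<inter> attr l \<Longrightarrow> d \<le> dist x y" by blast
    have "(\<lambda>n. D * norm l ^ n) \<longlonglongrightarrow> D * 0"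
      using norm_l by (intro tendsto_intros LIMSEQ_power_zero) auto
    then have "\<forall>\<^sub>F n in sequentially. D * norm l ^ n < d"
      using d(1) by (intro order_tendstoD) auto
    then obtain n where n: "D * norm l ^ n < d"
      by (auto simp: eventually_sequentially)
    have "x \<in> E \<longleftrightarrow> y \<in> E" if "x \<in> attr l" "y \<in> attr l" for x y
    proof (rule const[OF _ that, of n], intro ballI impI)
      fix x y assume xy: "x \<in> attr l" "y \<in> attr l" "norm (x - y) < D * norm l ^ n"
      then have "dist x y < d" "dist y x < d" using n by (auto simp: dist_norm norm_minus_commute)
      then show "x \<in> E \<longleftrightarrow> y \<in> E" using d(2)[of x y] d(2)[of y x] EF(3) xy by force
    qed
    then show False using EF by blast
  qed
qed

lemma joinable_branch:
  assumes "joinable (attr l) d x y"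
  shows "joinable (attr l) (norm l * d) (branch b x) (branch b y)"
proof -
  obtain C where C: "C \<subseteq> attr l" "connected C" "bounded C" "x \<in> C" "y \<in> C" "diameter C \<le> d"
    using assms unfolding joinable_def by blast
  have dist: "norm (u - v) \<le> norm l * d" if "u \<in> branch b ` C" "v \<in> branch b ` C" for u v
  proof -
    from that obtain u' v' where "u' \<in> C" "v' \<in> C" "u = branch b u'" "v = branch b v'" by auto
    then show ?thesis
      using diameter_bounded_bound[OF C(3), of u' v'] C(6)
      by (auto simp: branch_dist dist_norm intro!: mult_left_mono)
  qed
  have sub: "branch b ` C \<subseteq> attr l" using C branch_in by blast
  have "0 \<le> norm l * d"
    using dist[of "branch b x" "branch b x"] C by auto
  then have "diameter (branch b ` C) \<le> norm l * d"
    using dist by (intro diameter_le) auto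
  moreover have "connected (branch b ` C)"
    using C(2) continuous_branch by (intro connected_continuous_image)
  ultimately show ?thesis
    unfolding joinable_def using C sub bounded_subset[OF bounded_attr sub] by blast
qed

end

section \<open>The critical orbit\<close>

locale pcf_attractor = single_overlap +
  assumes is_pcf: "pcf l"
begin

text \<open>The index starts at \<open>Suc n\<close>, so the orbit begins with the critical value;
  \<open>opt l\<close> would occur in it only if it were periodic.\<close>

definition crit_orbit :: "complex set" where
  "crit_orbit = range (\<lambda>n. (qmap l ^^ Suc n) (opt l))"

lemma finite_crit_orbit: "finite crit_orbit"
proof -
  obtain m n where mn: "m \<noteq> n" "(qmap l ^^ m) (opt l) = (qmap l ^^ n) (opt l)"
    using is_pcf by (auto simp: pcf_def)
  then have "finite (range (\<lambda>k. (qmap l ^^ k) (opt l)))"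
    using finite_orbit[of m n] finite_orbit[of n m] by (metis linorder_neqE_nat)
  then show ?thesis
    unfolding crit_orbit_def by (rule finite_subset[rotated]) (rule image_subsetI, rule rangeI)
qed

text \<open>Strictness of the preperiodicity enters here. As the two images meet only in
  \<open>opt l\<close>, every post-critical point lies in exactly one of them.\<close>

lemma opt_notin_crit_orbit: "opt l \<notin> crit_orbit"
proof
  assume "opt l \<in> crit_orbit"
  then obtain n where "opt l = (qmap l ^^ Suc n) (opt l)" unfolding crit_orbit_def by blast
  then show False using is_pcf unfolding pcf_def by (metis le_add1 plus_1_eq_Suc)
qed

lemma crit_value_in_orbit: "opt l / l \<in> crit_orbit"
  unfolding crit_orbit_def by (rule range_eqI[of _ _ 0]) (simp add: qmap_opt)

lemma qmap_crit_orbit: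
  assumes "p \<in> crit_orbit"
  shows "qmap l p \<in> crit_orbit"
proof -
  obtain n where "p = (qmap l ^^ Suc n) (opt l)" using assms unfolding crit_orbit_def by blast
  then have "qmap l p = (qmap l ^^ Suc (Suc n)) (opt l)" by simp
  then show ?thesis unfolding crit_orbit_def by (rule range_eqI)
qed

lemma crit_orbit_induct [consumes 1, case_names base step]:
  assumes "p \<in> crit_orbit" and "P (opt l / l)"
    and "\<And>p. p \<in> crit_orbit \<Longrightarrow> P p \<Longrightarrow> P (qmap l p)"
  shows "P p"
proof -
  have "P ((qmap l ^^ Suc n) (opt l))" for n
  proof (induction n)
    case 0
    then show ?case using assms(2) by (simp add: qmap_opt)
  next
    case (Suc n)
    then show ?case using assms(3)[of "(qmap l ^^ Suc n) (opt l)"] by (auto simp: crit_orbit_def)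
  qed
  then show ?thesis using assms(1) by (auto simp: crit_orbit_def)
qed

lemma crit_orbit_in: "p \<in> crit_orbit \<Longrightarrow> p \<in> attr l"
  by (induction rule: crit_orbit_induct) (auto simp: crit_value_in qmap_in)

text \<open>
  For \<open>p = q\<^sup>n(o)\<close> the sets \<open>o + \<lambda>\<^sup>n (A - p)\<close> and \<open>o - \<lambda>\<^sup>n (A - p)\<close> lie in different images of
  \<open>A\<close>, so \<open>A - p\<close> meets its negative only in \<open>0\<close>.
\<close>

lemma crit_orbit_reflection:
  assumes "p \<in> crit_orbit" "x \<in> attr l" "y \<in> attr l" "x + y = 2 * p"
  shows "x = p"
  using assms
proof (induction arbitrary: x y rule: crit_orbit_induct)
  case base
  have "l * (x + y) = 2 * opt l" using base(3) l_nz by simp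
  then have "branch (\<not> True) x = branch True y" by (simp add: branch_def algebra_simps)
  then have "branch (\<not> True) x = opt l" using branch_overlap base by metis
  then show ?case by (simp only: branch_eq_opt_iff)
next
  case (step p)
  obtain b where b: "p = branch b (qmap l p)"
    using qmap_cases[OF crit_orbit_in[OF step(1)]] by blast
  \<comment> \<open>Affine maps preserve midpoints, so the induction hypothesis at \<open>p\<close>
    applies to the images of \<open>x\<close> and \<open>y\<close>.\<close>
  have "branch b x + branch b y = 2 * branch b (qmap l p)"
  proof (cases b)
    case True
    then show ?thesis using arg_cong[OF step(5), of "\<lambda>z. l * z"] by (simp add: branch_def algebra_simps)
  next
    case False
    then show ?thesis using arg_cong[OF step(5), of "\<lambda>z. l * z"] by (simp add: branch_def algebra_simps)
  qed
  then have "branch b x = p" using step branch_in b by metis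
  then show ?case using b branch_inj by metis
qed

text \<open>For fixed \<open>p\<close> and \<open>b\<close> the sums x + y form a compact set that
  misses \<open>2 * p\<close>, hence stay away from it. Only finitely many pairs \<open>p\<close>,
  \<open>b\<close> occur, so one bound serves them all.\<close>

lemma crit_orbit_separation:
  obtains d where "d > 0"
    "\<And>p b x y. \<lbrakk>p \<in> crit_orbit; p \<notin> branch b ` attr l; x \<in> branch b ` attr l; y \<in> attr l\<rbrakk>
       \<Longrightarrow> d \<le> norm (x + y - 2 * p)"
proof -
  have sep: "\<exists>d>0. \<forall>x\<in>branch b ` attr l. \<forall>y\<in>attr l. d \<le> norm (x + y - 2 * p)"
    if p: "p \<in> crit_orbit" "p \<notin> branch b ` attr l" for p b
  proof -
    let ?S = "(\<lambda>(x, y). x + y) ` (branch b ` attr l \<times> attr l)"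
    have "compact ?S"
      by (auto simp: case_prod_unfold intro!: compact_continuous_image compact_Times compact_attr
          continuous_branch continuous_intros)
    \<comment> \<open>If x + y = 2 p, reflection forces x = p, but \<open>x\<close> lies in the
      image that excludes \<open>p\<close>.\<close>
    moreover have "2 * p \<notin> ?S"
      using crit_orbit_reflection[OF p(1)] p(2) branch_in by fastforce
    ultimately obtain d where "d > 0" "\<And>s. s \<in> ?S \<Longrightarrow> d \<le> dist (2 * p) s"
      using separate_point_closed[OF compact_imp_closed] by metis
    then show ?thesis by (intro exI[of _ d]) (force simp: dist_norm norm_minus_commute)
  qed
  define I where "I = {(p, b). p \<in> crit_orbit \<and> p \<notin> branch b ` attr l}"
  have "\<exists>d>0. \<forall>x\<in>branch (snd i) ` attr l. \<forall>y\<in>attr l. d \<le> norm (x + y - 2 * fst i)"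
    if "i \<in> I" for i
    using that sep[of "fst i" "snd i"] by (auto simp: I_def)
  then obtain \<delta> where \<delta>: "\<And>i. i \<in> I \<Longrightarrow> 0 < \<delta> i \<and>
      (\<forall>x\<in>branch (snd i) ` attr l. \<forall>y\<in>attr l. \<delta> i \<le> norm (x + y - 2 * fst i))"
    by metis
  have fin: "finite I"
    by (rule finite_subset[of _ "crit_orbit \<times> UNIV"]) (auto simp: I_def finite_crit_orbit)
  show thesis
  proof (rule that[of "Min (insert 1 (\<delta> ` I))"])
    \<comment> \<open>The inserted 1 keeps the minimum meaningful in case \<open>I\<close> is
      empty.\<close>
    show "0 < Min (insert 1 (\<delta> ` I))" using fin \<delta> by simp
    fix p b x y
    assume *: "p \<in> crit_orbit" "p \<notin> branch b ` attr l" "x \<in> branch b ` attr l" "y \<in> attr l"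
    then have I: "(p, b) \<in> I" by (simp add: I_def)
    then have "Min (insert 1 (\<delta> ` I)) \<le> \<delta> (p, b)" using fin by simp
    also have "\<dots> \<le> norm (x + y - 2 * p)" using \<delta>[OF I] *(3,4) unfolding fst_conv snd_conv by blast
    finally show "Min (insert 1 (\<delta> ` I)) \<le> norm (x + y - 2 * p)" .
  qed
qed

text \<open>This is the dichotomy behind both estimates below: a point lies either in the image
  avoiding \<open>p\<close>, where separation applies, or in the image containing \<open>p\<close>,
  where \<open>qmap l\<close> expands it and \<open>p\<close> by the same branch.\<close>

lemma crit_orbit_cases:
  assumes "p \<in> crit_orbit"
  obtains b where "p = branch b (qmap l p)" "p \<notin> branch (\<not> b) ` attr l"
    "\<And>z. z \<in> attr l \<Longrightarrow> z \<in> branch (\<not> b) ` attr l \<or> z = branch b (qmap l z)"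
proof -
  obtain b where b: "qmap l p \<in> attr l" "p = branch b (qmap l p)"
    using qmap_cases[OF crit_orbit_in[OF assms]] by blast
  show thesis
  proof (rule that[OF b(2)])
    show "p \<notin> branch (\<not> b) ` attr l"
      using branch_overlap[OF _ b(1)] b(2) opt_notin_crit_orbit assms by (metis imageE)
    show "z \<in> branch (\<not> b) ` attr l \<or> z = branch b (qmap l z)" if z: "z \<in> attr l" for z
    proof -
      obtain b' where "qmap l z \<in> attr l" "z = branch b' (qmap l z)"
        using qmap_cases[OF z] by blast
      then show ?thesis by (cases "b' = b") auto
    qed
  qed
qed

section \<open>Uniform estimates at post-critical points and linear joining\<close>

definition D where "D = diameter (attr l)"

lemma D_bound: "x \<in> attr l \<Longrightarrow> y \<in> attr l \<Longrightarrow> norm (x - y) \<le> D"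
  using diameter_bounded_bound[OF bounded_attr] by (simp add: D_def dist_norm)

lemma joinable_attr: "x \<in> attr l \<Longrightarrow> y \<in> attr l \<Longrightarrow> joinable (attr l) D x y"
  unfolding joinable_def D_def using bounded_attr connected_attr by blast

lemma D_pos: "0 \<le> D"
  using D_bound[OF opt_in opt_in] by simp

lemma norm_sum_branch:
  "norm (branch b x + branch b y - 2 * branch b p) = norm l * norm (x + y - 2 * p)"
proof -
  have "branch b x + branch b y - 2 * branch b p
      = (if b then - (l * (x + y - 2 * p)) else l * (x + y - 2 * p))"
    by (simp add: branch_def algebra_simps)
  then show ?thesis by (simp add: norm_mult)
qed

text \<open>The right-hand norm is the distance from \<open>x\<close> to the reflection of
  \<open>y\<close> about \<open>p\<close>, so the attractor and its reflection do not touch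
  tangentially at \<open>p\<close>. If \<open>x\<close> or \<open>y\<close> lies in the image
  avoiding \<open>p\<close>, that distance is at least \<open>d\<close>; otherwise
  \<open>qmap l\<close> rescales both sides equally.\<close>

lemma reflection_estimate:
  obtains K where "0 < K"
    "\<And>p x y. \<lbrakk>p \<in> crit_orbit; x \<in> attr l; y \<in> attr l\<rbrakk> \<Longrightarrow> norm (x - p) \<le> K * norm (x + y - 2 * p)"
proof -
  obtain d where d: "d > 0" and sep: "\<And>p b x y. \<lbrakk>p \<in> crit_orbit; p \<notin> branch b ` attr l;
      x \<in> branch b ` attr l; y \<in> attr l\<rbrakk> \<Longrightarrow> d \<le> norm (x + y - 2 * p)"
    using crit_orbit_separation by blast
  \<comment> \<open>This makes \<open>K * d\<close> at least the diameter \<open>D\<close>; the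
    added 1 guarantees that \<open>K\<close> is positive.\<close>
  define K where "K = (D + 1) / d"
  define S where "S = crit_orbit \<times> attr l \<times> attr l"
  define P where "P = (\<lambda>(p :: complex, x, y). norm (x - p) \<le> K * norm (x + y - 2 * p))"
  define m where "m = (\<lambda>(p, x, y :: complex). norm (x - p :: complex))"
  have K: "0 < K" using D_pos d by (simp add: K_def)
  have large: "P (p, x, y)" if "(p, x, y) \<in> S" "d \<le> norm (x + y - 2 * p)" for p x y
  proof -
    have "norm (x - p) \<le> D" using D_bound crit_orbit_in that(1) by (simp add: S_def)
    also have "\<dots> \<le> K * d" using d by (simp add: K_def)
    also have "\<dots> \<le> K * norm (x + y - 2 * p)" using that(2) K by simp
    finally show ?thesis by (simp add: P_def)
  qed
  have "P s \<or> (\<exists>t\<in>S. m s = norm l * m t \<and> (P t \<longrightarrow> P s))" if s: "s \<in> S" for s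
  proof -
    obtain p x y where pxy: "s = (p, x, y)" "p \<in> crit_orbit" "x \<in> attr l" "y \<in> attr l"
      using s by (auto simp: S_def)
    obtain b where b: "p = branch b (qmap l p)" "p \<notin> branch (\<not> b) ` attr l"
      "\<And>z. z \<in> attr l \<Longrightarrow> z \<in> branch (\<not> b) ` attr l \<or> z = branch b (qmap l z)"
      using crit_orbit_cases[OF pxy(2)] by blast
    consider "x \<in> branch (\<not> b) ` attr l" | "y \<in> branch (\<not> b) ` attr l"
      | "x = branch b (qmap l x)" "y = branch b (qmap l y)"
      using b(3) pxy by blast
    then show ?thesis
    proof cases
      case 1
      then show ?thesis using large[of p x y] sep[OF pxy(2) b(2) 1 pxy(4)] s pxy by simp
    next
      case 2
      then show ?thesis
        using large[of p x y] sep[OF pxy(2) b(2) 2 pxy(3)] s pxy by (simp add: add.commute)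
    next
      case 3
      let ?t = "(qmap l p, qmap l x, qmap l y)"
      have "?t \<in> S" using pxy qmap_crit_orbit qmap_in by (auto simp: S_def)
      moreover have "norm (x - p) = norm l * norm (qmap l x - qmap l p)"
        using 3(1) b(1) branch_dist by metis
      moreover have "norm (x + y - 2 * p) = norm l * norm (qmap l x + qmap l y - 2 * qmap l p)"
        using 3 b(1) norm_sum_branch by metis
      ultimately show ?thesis
        using l_nz by (intro disjI2 bexI[of _ ?t]) (auto simp: P_def m_def pxy(1) mult.left_commute)
    qed
  qed
  then have "P s" if "s \<in> S" "0 < m s" for s
    using expansion_descent[where r = "norm l" and S = S and D = D and m = m and P = P]
      that norm_l l_nz D_bound crit_orbit_in
    by (auto simp: S_def m_def)
  \<comment> \<open>The descent needs a positive distance, so x = p is treated apart.\<close>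
  then have "norm (x - p) \<le> K * norm (x + y - 2 * p)"
    if "p \<in> crit_orbit" "x \<in> attr l" "y \<in> attr l" for p x y
    using that K by (cases "x = p") (force simp: S_def P_def m_def)+
  with K that show thesis by blast
qed

text \<open>Far from \<open>p\<close> the whole attractor serves as the joining set. Near
  \<open>p\<close> a joining set for the images under \<open>qmap l\<close> is carried back by the
  branch through \<open>p\<close>, which scales its diameter and the distance alike.\<close>

lemma joinable_crit_orbit:
  obtains L where "0 < L"
    "\<And>p x. \<lbrakk>p \<in> crit_orbit; x \<in> attr l\<rbrakk> \<Longrightarrow> joinable (attr l) (L * norm (x - p)) x p"
proof -
  obtain d where d: "d > 0" and sep: "\<And>p b x y. \<lbrakk>p \<in> crit_orbit; p \<notin> branch b ` attr l;
      x \<in> branch b ` attr l; y \<in> attr l\<rbrakk> \<Longrightarrow> d \<le> norm (x + y - 2 * p)"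
    using crit_orbit_separation by blast
  define L where "L = 2 * (D + 1) / d"
  define S where "S = crit_orbit \<times> attr l"
  define P where "P = (\<lambda>(p, x). joinable (attr l) (L * norm (x - p)) x p)"
  define m where "m = (\<lambda>(p :: complex, x). norm (x - p))"
  have L: "0 < L" using D_pos d by (simp add: L_def)
  have "P s \<or> (\<exists>t\<in>S. m s = norm l * m t \<and> (P t \<longrightarrow> P s))" if s: "s \<in> S" for s
  proof -
    obtain p x where px: "s = (p, x)" "p \<in> crit_orbit" "x \<in> attr l"
      using s by (auto simp: S_def)
    obtain b where b: "p = branch b (qmap l p)" "p \<notin> branch (\<not> b) ` attr l"
      "\<And>z. z \<in> attr l \<Longrightarrow> z \<in> branch (\<not> b) ` attr l \<or> z = branch b (qmap l z)"
      using crit_orbit_cases[OF px(2)] by blast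
    from b(3)[OF px(3)] show ?thesis
    proof
      assume x: "x \<in> branch (\<not> b) ` attr l"
      \<comment> \<open>Separation with both points equal to \<open>x\<close> bounds twice the
        distance to \<open>p\<close>; this explains the factor 2 in \<open>L\<close>.\<close>
      have "d \<le> norm (x + x - 2 * p)" by (rule sep[OF px(2) b(2) x px(3)])
      also have "x + x - 2 * p = 2 * (x - p)" by simp
      finally have far: "d \<le> 2 * norm (x - p)" by (simp only: norm_mult) simp
      have "D \<le> L * (d / 2)" using d by (simp add: L_def)
      also have "\<dots> \<le> L * norm (x - p)" using far L by simp
      finally have "P s"
        using joinable_mono[OF joinable_attr] px crit_orbit_in by (simp add: P_def)
      then show ?thesis ..
    next
      assume x: "x = branch b (qmap l x)"
      let ?t = "(qmap l p, qmap l x)"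
      have "?t \<in> S" using px qmap_crit_orbit qmap_in by (auto simp: S_def)
      moreover have scale: "norm (x - p) = norm l * norm (qmap l x - qmap l p)"
        using x b(1) branch_dist by metis
      moreover have "P s" if "P ?t"
      proof -
        have "joinable (attr l) (norm l * (L * norm (qmap l x - qmap l p)))
            (branch b (qmap l x)) (branch b (qmap l p))"
          using that by (intro joinable_branch) (simp add: P_def)
        then show ?thesis
          unfolding x[symmetric] b(1)[symmetric] by (simp add: P_def px(1) scale mult.left_commute)
      qed
      ultimately show ?thesis
        by (intro disjI2 bexI[of _ ?t]) (auto simp: m_def px(1))
    qed
  qed
  then have "P s" if "s \<in> S" "0 < m s" for s
    using expansion_descent[where r = "norm l" and S = S and D = D and m = m and P = P]
      that norm_l l_nz D_bound crit_orbit_in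
    by (auto simp: S_def m_def)
  then have "joinable (attr l) (L * norm (x - p)) x p" if "p \<in> crit_orbit" "x \<in> attr l" for p x
    using that joinable_refl[of x "attr l" 0] by (cases "x = p") (force simp: S_def P_def m_def)+
  with L that show thesis by blast
qed

text \<open>With c = \<open>opt l / l\<close>, the difference of the two points is, up to sign, l
  ((x - c) + (y - c)). The reflection estimate at c thus bounds the distances of both
  \<open>x\<close> and \<open>y\<close> from c, and the two points can be joined through
  \<open>opt l\<close>.\<close>

lemma joinable_across_opt:
  obtains L where "0 < L"
    "\<And>b x y. \<lbrakk>x \<in> attr l; y \<in> attr l\<rbrakk> \<Longrightarrow>
       joinable (attr l) (L * norm (branch b x - branch (\<not> b) y)) (branch b x) (branch (\<not> b) y)"
proof -
  obtain K where K: "0 < K"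
    "\<And>p x y. \<lbrakk>p \<in> crit_orbit; x \<in> attr l; y \<in> attr l\<rbrakk> \<Longrightarrow> norm (x - p) \<le> K * norm (x + y - 2 * p)"
    using reflection_estimate by blast
  obtain L where L: "0 < L"
    "\<And>p x. \<lbrakk>p \<in> crit_orbit; x \<in> attr l\<rbrakk> \<Longrightarrow> joinable (attr l) (L * norm (x - p)) x p"
    using joinable_crit_orbit by blast
  let ?c = "opt l / l"
  show thesis
  proof (rule that[of "2 * L * K"])
    fix b x y assume x: "x \<in> attr l" and y: "y \<in> attr l"
    define e where "e = norm (branch b x - branch (\<not> b) y)"
    have "branch b x - branch (\<not> b) y
        = (if b then - (l * (x + y - 2 * ?c)) else l * (x + y - 2 * ?c))"
      using l_nz by (simp add: branch_def algebra_simps)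
    then have e: "e = norm l * norm (x + y - 2 * ?c)"
      unfolding e_def by (simp add: norm_mult split del: if_split) (auto simp: norm_mult)
    \<comment> \<open>Only the sum of \<open>z\<close> and \<open>w\<close> is prescribed, so the
      same fact covers \<open>x\<close> and, with the roles exchanged, \<open>y\<close>.\<close>
    have to_opt: "joinable (attr l) (L * K * e) (branch b' z) (opt l)"
      if zw: "z \<in> attr l" "w \<in> attr l" "z + w = x + y" for b' z w
    proof -
      have "joinable (attr l) (norm l * (L * norm (z - ?c))) (branch b' z) (branch b' ?c)"
        using zw L(2) crit_value_in_orbit by (intro joinable_branch)
      moreover have "branch b' ?c = opt l" by (simp only: branch_eq_opt_iff)
      moreover have "norm l * (L * norm (z - ?c)) \<le> L * K * e"
      proof -
        have "norm (z - ?c) \<le> K * norm (x + y - 2 * ?c)"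
          using K(2)[OF crit_value_in_orbit zw(1,2)] zw(3) by simp
        then have "norm l * L * norm (z - ?c) \<le> norm l * L * (K * norm (x + y - 2 * ?c))"
          using L(1) by (intro mult_left_mono) auto
        then show ?thesis by (simp add: e mult_ac)
      qed
      ultimately show ?thesis using joinable_mono by metis
    qed
    have "joinable (attr l) (L * K * e + L * K * e) (branch b x) (branch (\<not> b) y)"
      by (rule joinable_trans[OF to_opt[of x y b] joinable_sym[OF to_opt[of y x "\<not> b"]]])
        (use x y in auto)
    then show "joinable (attr l) (2 * L * K * norm (branch b x - branch (\<not> b) y))
        (branch b x) (branch (\<not> b) y)"
      by (simp add: e_def mult_ac)
  qed (use K L in simp)
qed

text \<open>The constant for points in different images works for all pairs: a common branch
  multiplies the distance and the joining diameter by the same factor, so nothing is lost along the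
  descent.\<close>

lemma joinable_linear:
  obtains L where "0 < L"
    "\<And>x y. \<lbrakk>x \<in> attr l; y \<in> attr l\<rbrakk> \<Longrightarrow> joinable (attr l) (L * norm (x - y)) x y"
proof -
  obtain L where L: "0 < L"
    "\<And>b x y. \<lbrakk>x \<in> attr l; y \<in> attr l\<rbrakk> \<Longrightarrow>
       joinable (attr l) (L * norm (branch b x - branch (\<not> b) y)) (branch b x) (branch (\<not> b) y)"
    using joinable_across_opt by blast
  define S where "S = attr l \<times> attr l"
  define P where "P = (\<lambda>(x, y). joinable (attr l) (L * norm (x - y)) x y)"
  define m where "m = (\<lambda>(x :: complex, y). norm (x - y))"
  have "P s \<or> (\<exists>t\<in>S. m s = norm l * m t \<and> (P t \<longrightarrow> P s))" if s: "s \<in> S" for s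
  proof -
    obtain x y where xy: "s = (x, y)" "x \<in> attr l" "y \<in> attr l" using s by (auto simp: S_def)
    obtain b where b: "qmap l x \<in> attr l" "x = branch b (qmap l x)"
      using qmap_cases[OF xy(2)] by blast
    obtain b' where b': "qmap l y \<in> attr l" "y = branch b' (qmap l y)"
      using qmap_cases[OF xy(3)] by blast
    show ?thesis
    proof (cases "b' = b")
      case False
      then have neq: "b' = (\<not> b)" by auto
      have "P s"
        using L(2)[OF b(1) b'(1), of b]
        unfolding b(2)[symmetric] b'(2)[unfolded neq, symmetric] by (simp add: P_def xy(1))
      then show ?thesis ..
    next
      case True
      let ?t = "(qmap l x, qmap l y)"
      have scale: "norm (x - y) = norm l * norm (qmap l x - qmap l y)"
        using branch_dist[of b "qmap l x" "qmap l y"]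
        unfolding b(2)[symmetric] b'(2)[unfolded True, symmetric] .
      have "P s" if "P ?t"
      proof -
        have "joinable (attr l) (norm l * (L * norm (qmap l x - qmap l y)))
            (branch b (qmap l x)) (branch b (qmap l y))"
          using that by (intro joinable_branch) (simp add: P_def)
        then show ?thesis
          unfolding b(2)[symmetric] b'(2)[unfolded True, symmetric]
          by (simp add: P_def xy(1) scale mult.left_commute)
      qed
      then show ?thesis
        using scale b(1) b'(1) by (intro disjI2 bexI[of _ ?t]) (auto simp: m_def S_def xy(1))
    qed
  qed
  then have "P s" if "s \<in> S" "0 < m s" for s
    using expansion_descent[where r = "norm l" and S = S and D = D and m = m and P = P]
      that norm_l l_nz D_bound
    by (auto simp: S_def m_def)
  then have "joinable (attr l) (L * norm (x - y)) x y" if "x \<in> attr l" "y \<in> attr l" for x y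
    using that joinable_refl[of x "attr l" 0] by (cases "x = y") (force simp: S_def P_def m_def)+
  with L(1) that show thesis by blast
qed

end

theorem theorem2p1:
  assumes "l \<in> Tset" and "pcf l"
  shows "bounded_turning (attr l)"
proof -
  interpret pcf_attractor l
    using assms by unfold_locales
  obtain L where L: "0 < L"
    "\<And>x y. \<lbrakk>x \<in> attr l; y \<in> attr l\<rbrakk> \<Longrightarrow> joinable (attr l) (L * norm (x - y)) x y"
    using joinable_linear by blast
  have "locally connected (attr l)"
    using L by (rule locally_connected_if_joinable)
  then show ?thesis
    unfolding bounded_turning_def using connected_attr L(2) unfolding joinable_def by blast
qed

end
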